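(* Let $n_c\ge 2$, $n_v\ge 1$, $N\ge 1$, let $P_{ij}$ ($1\le i\le n_c$, $1\le j\le n_v$) be arbitrary $N\times N$ permutation matrices, and let $H_{n_c}=(P_{ij})$ be the resulting $n_cN\times n_vN$ matrix. Then for every integer $m\ge 2$, $\mathrm{girth}(H_{n_c})>2m$ if and only if all $\min(m,n_c)\times n_v$ (block) submatrices of $H_{n_c}$ have girth greater than $2m$.
   Context: The Tanner graph of a $0/1$ matrix is the bipartite graph with one check node per row, one variable node per column, and an edge between check node $a$ and variable node $b$ iff the $(a,b)$ entry is $1$. $\mathrm{girth}(M)$ is the length of a shortest cycle in the Tanner graph of $M$ ($+\infty$ if there is none). An $r\times n_v$ block submatrix of $H_{n_c}$ is the $rN\times n_vN$ matrix obtained by choosing $r$ of the $n_c$ block rows $[P_{i1}\ \cdots\ P_{in_v}]$ and keeping all $n_v$ block columns. *)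

theory Defs
  imports
    "Jordan_Normal_Form.DL_Submatrix"
    "Graph_Theory.Graph_Theory"
    "HOL-Combinatorics.Permutations"
    "HOL-Library.Extended_Nat"
begin

(* Check nodes are Inl a (row a), variable nodes are Inr b (column b), with 0-based indices.
   Undirected graphs are rendered as symmetric digraphs: each edge gives two opposite arcs. *)
definition tanner_graph :: "'a::one mat \<Rightarrow> (nat + nat) pair_pre_digraph" where
  "tanner_graph M =
    \<lparr> pverts = Inl ` {..<dim_row M} \<union> Inr ` {..<dim_col M},
      parcs = {(Inl a, Inr b) | a b. a < dim_row M \<and> b < dim_col M \<and> M $$ (a, b) = 1}
            \<union> {(Inr b, Inl a) | a b. a < dim_row M \<and> b < dim_col M \<and> M $$ (a, b) = 1} \<rparr>"

lemma pair_graph_tanner_graph: "pair_graph (tanner_graph M)"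
proof
  show "symmetric (with_proj (tanner_graph M))"
    by (auto simp: tanner_graph_def symmetric_def sym_def arcs_ends_def arc_to_ends_def)
  show "finite (parcs (tanner_graph M))"
    by (rule finite_subset[of _ "pverts (tanner_graph M) \<times> pverts (tanner_graph M)"])
      (auto simp: tanner_graph_def)
qed (auto simp: tanner_graph_def)

(* In a symmetric digraph, pre_digraph.cycle also accepts the walk of length 2 that traverses
   one edge back and forth; this is not a cycle of the undirected graph, hence the bound 3.
   The infimum of the empty set in enat is infinity. *)
definition graph_girth :: "'v pair_pre_digraph \<Rightarrow> enat" where
  "graph_girth G = (INF p \<in> {p. pre_digraph.cycle (with_proj G) p \<and> 3 \<le> length p}. enat (length p))"

definition girth :: "'a::one mat \<Rightarrow> enat" where
  "girth M = graph_girth (tanner_graph M)"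

definition permutation_matrix :: "nat \<Rightarrow> 'a::zero_neq_one mat \<Rightarrow> bool" where
  "permutation_matrix N A \<longleftrightarrow>
    (\<exists>\<pi>. \<pi> permutes {..<N} \<and> A = mat N N (\<lambda>(a, b). if b = \<pi> a then 1 else 0))"

definition block_matrix :: "nat \<Rightarrow> nat \<Rightarrow> nat \<Rightarrow> (nat \<Rightarrow> nat \<Rightarrow> 'a mat) \<Rightarrow> 'a mat" where
  "block_matrix n\<^sub>c n\<^sub>v N P =
    mat (n\<^sub>c * N) (n\<^sub>v * N) (\<lambda>(a, b). P (a div N) (b div N) $$ (a mod N, b mod N))"

(* Keeps the block rows with index in R (row a lies in block row a div N) and all columns. *)
definition block_row_submatrix :: "nat \<Rightarrow> 'a mat \<Rightarrow> nat set \<Rightarrow> 'a mat" where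
  "block_row_submatrix N H R = submatrix H {a. a div N \<in> R} UNIV"

end

(* The arcs of a cycle in a Tanner graph alternate between check and variable nodes, so a cycle of
   length at most 2 m passes through at most m rows and hence at most m block rows. It therefore
   survives in any block submatrix whose chosen block rows include these, and conversely each cycle
   of a block submatrix is a cycle of the full matrix. *)
theory Submission
  imports Defs
begin

section \<open>Cycles and girth in pair digraphs\<close>

lemma cycle_with_proj_iff:
  fixes G :: "'v pair_pre_digraph"
  assumes "pair_wf_digraph G"
  shows "pre_digraph.cycle (with_proj G) p \<longleftrightarrow>
    p \<noteq> [] \<and> set p \<subseteq> parcs G \<and>
    pre_digraph.cas (with_proj G) (fst (hd p)) p (fst (hd p)) \<and> distinct (map snd p)"
proof -
  interpret pair_wf_digraph G by fact
  show ?thesis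
  proof (cases p)
    case (Cons e q)
    show ?thesis
    proof (cases "cas (fst e) p (fst e)")
      case True
      \<comment> \<open>The vertex list of a nonempty walk is its start vertex followed by the heads
        of its arcs. Distinctness in a cycle is therefore a condition on heads alone, and the start
        vertex must be the tail of the first arc.\<close>
      then have "tl (awalk_verts (fst e) p) = map snd p"
        using awalk_verts_conv'[OF True] by (simp add: Cons del: awalk_verts.simps)
      with True show ?thesis
        by (cases e) (auto simp: Cons cycle_def awalk_def intro: in_arcsD1)
    qed (auto simp: Cons cycle_def awalk_def)
  qed (simp add: cycle_def)
qed

lemma cas_with_proj_map:
  assumes "pre_digraph.cas (with_proj G) u p v"
  shows "pre_digraph.cas (with_proj H) (f u) (map (map_prod f f) p) (f v)"
  using assms
proof (induction p arbitrary: u)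
  case Nil
  then show ?case by (simp add: pre_digraph.cas.simps)
next
  case (Cons e p)
  from Cons.prems have "fst e = u" "pre_digraph.cas (with_proj G) (snd e) p v"
    by (simp_all add: pre_digraph.cas.simps)
  with Cons.IH[of "snd e"] show ?case
    by (simp add: pre_digraph.cas.simps)
qed

text \<open>Since the cycle property concerns only the arcs of \<open>p\<close> and their heads,
  \<open>f\<close> has to respect those arcs and be injective on those heads. Asking for no more
  allows renumberings of rows that make sense only along the cycle.\<close>

lemma cycle_with_proj_map:
  assumes "pair_wf_digraph G" "pair_wf_digraph H"
    and cyc: "pre_digraph.cycle (with_proj G) p"
    and arcs: "\<And>u v. (u, v) \<in> set p \<Longrightarrow> (f u, f v) \<in> parcs H"
    and inj: "inj_on f (snd ` set p)"
  shows "pre_digraph.cycle (with_proj H) (map (map_prod f f) p)"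
proof -
  from cyc have p: "p \<noteq> []" "distinct (map snd p)"
    "pre_digraph.cas (with_proj G) (fst (hd p)) p (fst (hd p))"
    by (simp_all add: cycle_with_proj_iff[OF assms(1)])
  have "distinct (map f (map snd p))"
    using p(2) inj by (subst distinct_map) auto
  then have "distinct (map snd (map (map_prod f f) p))"
    by (simp add: comp_def)
  moreover have "set (map (map_prod f f) p) \<subseteq> parcs H"
    using arcs by auto
  ultimately show ?thesis
    using p(1) cas_with_proj_map[OF p(3), of H f]
    by (simp add: cycle_with_proj_iff[OF assms(2)] hd_map)
qed

text \<open>A strict lower bound on all members does not in general carry over to an infimum. In
  \<open>enat\<close>, however, \<open>enat k < x\<close> is the weak bound
  \<open>enat (Suc k) \<le> x\<close>, which does.\<close>

lemma enat_less_graph_girth_iff: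
  "enat k < graph_girth G \<longleftrightarrow>
    (\<forall>p. pre_digraph.cycle (with_proj G) p \<and> 3 \<le> length p \<longrightarrow> k < length p)"
proof -
  have "enat k < graph_girth G \<longleftrightarrow> enat (Suc k) \<le> graph_girth G"
    by (simp only: Suc_ile_eq)
  then show ?thesis
    by (simp only: graph_girth_def le_INF_iff enat_ord_simps Suc_le_eq) blast
qed

section \<open>Walks and cycles in Tanner graphs\<close>

lemma pair_wf_digraph_tanner_graph: "pair_wf_digraph (tanner_graph M)"
proof -
  interpret pair_graph "tanner_graph M" by (rule pair_graph_tanner_graph)
  show ?thesis by unfold_locales
qed

lemma parcs_tanner_graph_iff:
  "(Inl a, Inr b) \<in> parcs (tanner_graph M) \<longleftrightarrow> a < dim_row M \<and> b < dim_col M \<and> M $$ (a, b) = 1"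
  "(Inr b, Inl a) \<in> parcs (tanner_graph M) \<longleftrightarrow> a < dim_row M \<and> b < dim_col M \<and> M $$ (a, b) = 1"
  "(Inl a, Inl a') \<notin> parcs (tanner_graph M)"
  "(Inr b, Inr b') \<notin> parcs (tanner_graph M)"
  by (auto simp: tanner_graph_def)

lemma tanner_graph_arc_alternates:
  "(u, v) \<in> parcs (tanner_graph M) \<Longrightarrow> isl u \<longleftrightarrow> \<not> isl v"
  by (auto simp: tanner_graph_def)

text \<open>Every arc changes sides, so about half of the heads are check nodes. The
  \<open>of_bool\<close> terms correct for the sides of the two ends and make the count exact for
  open walks too, as the induction requires; for closed walks they cancel.\<close>

lemma length_tanner_walk:
  assumes "pre_digraph.cas (with_proj (tanner_graph M)) u p v" "set p \<subseteq> parcs (tanner_graph M)"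
  shows "2 * length (filter isl (map snd p)) + of_bool (isl u) = length p + of_bool (isl v)"
  using assms
proof (induction p arbitrary: u)
  case Nil
  then show ?case by (simp add: pre_digraph.cas.simps)
next
  case (Cons e p)
  obtain x y where "e = (x, y)" by fastforce
  with Cons.prems have "x = u" "pre_digraph.cas (with_proj (tanner_graph M)) y p v"
    "set p \<subseteq> parcs (tanner_graph M)" and arc: "(x, y) \<in> parcs (tanner_graph M)"
    by (simp_all add: pre_digraph.cas.simps)
  with Cons.IH[of y] tanner_graph_arc_alternates[OF arc] \<open>e = (x, y)\<close> show ?case
    by (cases "isl y") simp_all
qed

text \<open>Only heads are collected, because a cycle has distinct heads and they can be counted. On
  a cycle no row is missed, as \<open>tanner_cycle_fst\<close> shows.\<close>

definition walk_rows :: "((nat + nat) \<times> (nat + nat)) list \<Rightarrow> nat set" where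
  "walk_rows p = {a. Inl a \<in> snd ` set p}"

text \<open>Exactly half of the heads of a closed walk are check nodes, and on a cycle these are
  distinct, so counting occurrences is counting rows.\<close>

lemma length_tanner_cycle:
  assumes "pre_digraph.cycle (with_proj (tanner_graph M)) p"
  shows "length p = 2 * card (walk_rows p)"
proof -
  from assms have "set p \<subseteq> parcs (tanner_graph M)" "distinct (map snd p)"
    "pre_digraph.cas (with_proj (tanner_graph M)) (fst (hd p)) p (fst (hd p))"
    by (simp_all add: cycle_with_proj_iff[OF pair_wf_digraph_tanner_graph])
  then have "length p = 2 * length (filter isl (map snd p))"
    using length_tanner_walk[of M "fst (hd p)" p "fst (hd p)"] by simp
  also have "length (filter isl (map snd p)) = card (set (filter isl (map snd p)))"
    using \<open>distinct (map snd p)\<close> by (intro distinct_card[symmetric] distinct_filter)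
  also have "set (filter isl (map snd p)) = Inl ` walk_rows p"
    by (auto simp: walk_rows_def image_iff Bex_def isl_def)
  also have "card \<dots> = card (walk_rows p)"
    by (simp add: card_image)
  finally show ?thesis .
qed

lemma cas_with_proj_fst_subset:
  assumes "pre_digraph.cas (with_proj G) u p v"
  shows "fst ` set p \<subseteq> insert u (snd ` set p)"
  using assms
proof (induction p arbitrary: u)
  case (Cons e p)
  then have "fst ` set p \<subseteq> insert (snd e) (snd ` set p)" "fst e = u"
    by (simp_all add: pre_digraph.cas.simps)
  then show ?case by auto
qed simp

lemma cas_with_proj_end:
  assumes "pre_digraph.cas (with_proj G) u p v" "p \<noteq> []"
  shows "v \<in> snd ` set p"
  using assms
proof (induction p arbitrary: u)
  case (Cons e p)
  then have "pre_digraph.cas (with_proj G) (snd e) p v"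
    by (simp add: pre_digraph.cas.simps)
  with Cons.IH[of "snd e"] show ?case
    by (cases "p = []") (auto simp: pre_digraph.cas.simps)
qed simp

lemma tanner_cycle_fst:
  assumes "pre_digraph.cycle (with_proj (tanner_graph M)) p" "(Inl a, v) \<in> set p"
  shows "a \<in> walk_rows p"
proof -
  from assms(1) have "p \<noteq> []"
    and walk: "pre_digraph.cas (with_proj (tanner_graph M)) (fst (hd p)) p (fst (hd p))"
    by (simp_all add: cycle_with_proj_iff[OF pair_wf_digraph_tanner_graph])
  have "Inl a \<in> fst ` set p"
    using assms(2) by (metis fst_conv image_eqI)
  with cas_with_proj_fst_subset[OF walk] have "Inl a \<in> insert (fst (hd p)) (snd ` set p)"
    by (rule subsetD)
  \<comment> \<open>A tail is the head of the preceding arc or the start vertex. The walk is closed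
    and nonempty, so the start vertex is the head of the last arc.\<close>
  also have "insert (fst (hd p)) (snd ` set p) = snd ` set p"
    by (rule insert_absorb[OF cas_with_proj_end[OF walk \<open>p \<noteq> []\<close>]])
  finally show ?thesis
    by (simp only: walk_rows_def mem_Collect_eq)
qed

lemma walk_rows_bound:
  assumes "pre_digraph.cycle (with_proj (tanner_graph M)) p"
  shows "walk_rows p \<subseteq> {..<dim_row M}"
proof -
  have sub: "set p \<subseteq> parcs (tanner_graph M)"
    using assms by (simp add: cycle_with_proj_iff[OF pair_wf_digraph_tanner_graph])
  have "a < dim_row M" if a: "a \<in> walk_rows p" for a
  proof -
    from a obtain u where "(u, Inl a) \<in> set p"
      by (auto simp: walk_rows_def)
    with sub have "(u, Inl a) \<in> parcs (tanner_graph M)"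
      by (rule subsetD)
    then show ?thesis
      by (cases u) (simp_all add: parcs_tanner_graph_iff)
  qed
  then show ?thesis by blast
qed

section \<open>Selecting rows of a matrix\<close>

lemma pick_below:
  assumes "i < card {i. i < n \<and> i \<in> I}"
  shows "pick I i < n" "pick I i \<in> I" "card {a \<in> I. a < pick I i} = i"
proof -
  \<comment> \<open>For infinite \<open>I\<close> the value of \<open>card I\<close> is 0, so the
    comparison is made for finite \<open>I\<close> only; \<open>pick I i\<close> is meaningful at
    every \<open>i\<close> when \<open>I\<close> is infinite.\<close>
  have "card {i. i < n \<and> i \<in> I} \<le> card I" if "finite I"
    using that by (rule card_mono) blast
  with assms have "i < card I \<or> infinite I"
    by linarith
  then show "pick I i \<in> I" "card {a \<in> I. a < pick I i} = i"
    by (fact pick_in_set, fact card_pick)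
  show "pick I i < n"
    using assms by (rule pick_le)
qed

text \<open>All columns are kept, so renumbering the rows matches cycles of the submatrix with the
  cycles of \<open>M\<close> confined to rows in \<open>I\<close>, preserving length. All row
  submatrices can then be compared inside the one Tanner graph of \<open>M\<close>.\<close>

lemma enat_less_girth_row_submatrix_iff:
  "enat k < girth (submatrix M I UNIV) \<longleftrightarrow>
    (\<forall>p. pre_digraph.cycle (with_proj (tanner_graph M)) p \<and> 3 \<le> length p \<and> walk_rows p \<subseteq> I
      \<longrightarrow> k < length p)"
  (is "_ < girth ?S \<longleftrightarrow> ?R")
proof
  note wf = pair_wf_digraph_tanner_graph
  assume L: "enat k < girth ?S"
  show ?R
  proof (intro allI impI; elim conjE)
    fix p
    assume cyc: "pre_digraph.cycle (with_proj (tanner_graph M)) p"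
      and len: "3 \<le> length p" and rows: "walk_rows p \<subseteq> I"
    \<comment> \<open>A row in \<open>I\<close> is sent to its position in \<open>I\<close>, which
      \<open>pick I\<close> inverts; columns stay fixed, as \<open>pick UNIV\<close> is the
      identity.\<close>
    define f :: "nat + nat \<Rightarrow> nat + nat" where "f = map_sum (\<lambda>a. card {x \<in> I. x < a}) id"
    have sub: "set p \<subseteq> parcs (tanner_graph M)"
      using cyc by (simp add: cycle_with_proj_iff[OF wf])
    have arc: "(f u, f v) \<in> parcs (tanner_graph ?S)" if "(u, v) \<in> set p" for u v
    proof -
      \<comment> \<open>The row \<open>a\<close> itself lies in the larger set only, so its new
        index stays strictly below the number of rows of \<open>?S\<close>.\<close>
      have "{x \<in> I. x < a} \<subset> {i. i < dim_row M \<and> i \<in> I}" if "a < dim_row M" "a \<in> I" for a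
        using that by auto
      then have lt: "card {x \<in> I. x < a} < card {i. i < dim_row M \<and> i \<in> I}"
        if "a < dim_row M" "a \<in> I" for a
        using that by (simp add: psubset_card_mono)
      from that sub have "(u, v) \<in> parcs (tanner_graph M)" by auto
      \<comment> \<open>The hypothesis on \<open>walk_rows p\<close> speaks of heads; a tail is
        covered because it is also the head of some arc of the cycle.\<close>
      moreover have "a \<in> I" if "u = Inl a" for a
        using tanner_cycle_fst[OF cyc] \<open>(u, v) \<in> set p\<close> rows that by auto
      moreover have "a \<in> I" if "v = Inl a" for a
        using \<open>(u, v) \<in> set p\<close> rows that by (force simp: walk_rows_def)
      ultimately show ?thesis
        by (cases u; cases v)
          (auto simp: f_def parcs_tanner_graph_iff dim_submatrix submatrix_index lt
            pick_card_in_set pick_UNIV)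
    qed
    have "inj_on f (snd ` set p)"
    proof (rule inj_on_inverseI)
      fix v assume "v \<in> snd ` set p"
      then show "map_sum (pick I) id (f v) = v"
        using rows by (cases v) (auto simp: f_def walk_rows_def pick_card_in_set subset_iff)
    qed
    from cycle_with_proj_map[OF wf wf cyc arc this] len L show "k < length p"
      by (fastforce simp: girth_def enat_less_graph_girth_iff)
  qed
next
  assume R: ?R
  note wf = pair_wf_digraph_tanner_graph
  show "enat k < girth ?S"
    unfolding girth_def enat_less_graph_girth_iff
  proof (intro allI impI; elim conjE)
    fix p
    assume cyc: "pre_digraph.cycle (with_proj (tanner_graph ?S)) p" and len: "3 \<le> length p"
    \<comment> \<open>The renumbering in the opposite direction: row \<open>i\<close> of the
      submatrix is the row \<open>pick I i\<close> of \<open>M\<close>.\<close>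
    define f :: "nat + nat \<Rightarrow> nat + nat" where "f = map_sum (pick I) id"
    have rows: "walk_rows p \<subseteq> {..<card {i. i < dim_row M \<and> i \<in> I}}"
      using walk_rows_bound[OF cyc] by (simp add: dim_submatrix)
    have sub: "set p \<subseteq> parcs (tanner_graph ?S)"
      using cyc by (simp add: cycle_with_proj_iff[OF wf])
    have arc: "(f u, f v) \<in> parcs (tanner_graph M)" if "(u, v) \<in> set p" for u v
      using subsetD[OF sub that]
      by (cases u; cases v)
        (auto simp: f_def parcs_tanner_graph_iff dim_submatrix submatrix_index pick_UNIV
          pick_below)
    have inj: "inj_on f (snd ` set p)"
    proof (rule inj_on_inverseI)
      fix v assume "v \<in> snd ` set p"
      then show "map_sum (\<lambda>a. card {x \<in> I. x < a}) id (f v) = v"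
        using rows by (cases v) (auto simp: f_def walk_rows_def pick_below subset_iff)
    qed
    have "a \<in> I" if "(u, v) \<in> set p" "f v = Inl a" for u v a
      using that rows by (cases v) (force simp: f_def walk_rows_def intro: pick_below(2))+
    then have "walk_rows (map (map_prod f f) p) \<subseteq> I"
      by (force simp: walk_rows_def)
    with cycle_with_proj_map[OF wf wf cyc arc inj] len R show "k < length p"
      by fastforce
  qed
qed

theorem theorem13:
  fixes P :: "nat \<Rightarrow> nat \<Rightarrow> 'a::zero_neq_one mat"
    and n\<^sub>c n\<^sub>v N m :: nat
  assumes "n\<^sub>c \<ge> 2" and "n\<^sub>v \<ge> 1" and "N \<ge> 1"
    and "\<And>i j. i < n\<^sub>c \<Longrightarrow> j < n\<^sub>v \<Longrightarrow> permutation_matrix N (P i j)"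
    and "m \<ge> 2"
  shows "girth (block_matrix n\<^sub>c n\<^sub>v N P) > enat (2 * m) \<longleftrightarrow>
    (\<forall>R. R \<subseteq> {..<n\<^sub>c} \<and> card R = min m n\<^sub>c \<longrightarrow>
      girth (block_row_submatrix N (block_matrix n\<^sub>c n\<^sub>v N P) R) > enat (2 * m))"
    (is "enat _ < girth ?H \<longleftrightarrow> ?R")
proof
  \<comment> \<open>Here the bound holds for all cycles of \<open>?H\<close>, in particular for
    those confined to the chosen block rows.\<close>
  assume "enat (2 * m) < girth ?H"
  then show ?R
    by (auto simp: block_row_submatrix_def enat_less_girth_row_submatrix_iff girth_def[of ?H]
        enat_less_graph_girth_iff)
next
  assume R: ?R
  show "enat (2 * m) < girth ?H"
    unfolding girth_def enat_less_graph_girth_iff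
  proof (intro allI impI; elim conjE)
    fix p
    assume cyc: "pre_digraph.cycle (with_proj (tanner_graph ?H)) p" and len: "3 \<le> length p"
    show "2 * m < length p"
    proof (rule ccontr)
      assume short: "\<not> 2 * m < length p"
      let ?B = "(\<lambda>a. a div N) ` walk_rows p"
      have rows: "walk_rows p \<subseteq> {..<n\<^sub>c * N}"
        using walk_rows_bound[OF cyc] by (simp add: block_matrix_def)
      then have B: "?B \<subseteq> {..<n\<^sub>c}"
        by (auto simp: less_mult_imp_div_less)
      have "card ?B \<le> card (walk_rows p)"
        using rows by (intro card_image_le) (auto intro: finite_subset)
      also have "\<dots> \<le> m"
        using short length_tanner_cycle[OF cyc] by simp
      finally have "card ?B \<le> min m n\<^sub>c"
        using card_mono[OF _ B] by simp
      \<comment> \<open>The cycle may meet fewer than \<open>min m n\<^sub>c\<close> block rows,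
        while \<open>?R\<close> speaks of exactly that many. The set \<open>?B\<close> is filled up
        with further block rows, of which there are enough because \<open>min m n\<^sub>c\<close> is
        at most \<open>n\<^sub>c\<close>.\<close>
      then obtain S where S: "?B \<subseteq> S" "S \<subseteq> {..<n\<^sub>c}" "card S = min m n\<^sub>c"
        using exists_subset_between[OF _ _ B, of "min m n\<^sub>c"] by auto
      with R have "enat (2 * m) < girth (submatrix ?H {a. a div N \<in> S} UNIV)"
        by (simp add: block_row_submatrix_def)
      moreover have "walk_rows p \<subseteq> {a. a div N \<in> S}"
        using S(1) by auto
      ultimately show False
        using cyc len short unfolding enat_less_girth_row_submatrix_iff by blast
    qed
  qed
qed

end
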